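(* Let $f=\sum_{i=1}^m f_i$ with $f_i:\mathbb{R}^n\to\mathbb{R}$, $f^*=\min_{x\in\mathbb{R}^n} f(x)$ finite and $\mathcal{X}^*=\{x\in\mathbb{R}^n : f(x)=f^*\}$ nonempty. Let $\{x_i(k)\}_{k\ge 1}$, $i=1,\dots,m$, be generated from arbitrary initial points $x_i(1)\in\mathbb{R}^n$ by $$x_i(k+1)=\sum_{j=1}^m w_{ij}(k)\,x_j(k)-\alpha_k\, g_{i,\delta}(k),\qquad k\ge 1,$$ where $(f_{i,\delta}(k),g_{i,\delta}(k))\in\mathbb{R}\times\mathbb{R}^n$ is the pair returned by a first-order $(\delta,L)$-oracle of $f_i$ at the point $x_i(k)$, and let $x_{\rm av}(k)=\frac1m\sum_{i=1}^m x_i(k)$. Suppose that: (1) each $f_i$ is convex and admits a first-order $(\delta,L)$-oracle; (2) there is a constant $C>0$ with $\|g_{i,\delta}(k)\|\le C$ for all $k\ge 1$ and all $i=1,\dots,m$; (3) the undirected communication graph $\mathcal{G}_k$ is connected for every $k\ge 1$; (4) for every $k\ge1$ the matrix $W(k)=[w_{ij}(k)]_{m\times m}$ is doubly stochastic, and there is a constant $\eta>0$ (independent of $k$) such that for all $i$, $w_{ii}(k)\ge\eta$, and $w_{ij}(k)\ge\eta$ whenever $(j,i)\in\mathcal{E}_k$; (5) the step sizes $\alpha_k$ are positive and satisfy $\sum_{k=1}^\infty\alpha_k=\infty$ and $\sum_{k=1}^\infty\alpha_k^2<\infty$. Then $$\liminf_{k\to\infty} f(x_{\rm av}(k))\le 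f^*+m\delta.$$
   Context: A convex function $h:\mathbb{R}^n\to\mathbb{R}$ admits a first-order $(\delta,L)$-oracle (with accuracy $\delta\ge 0$) if for any point $x\in\mathbb{R}^n$ one has a pair $(h_{\delta,L}(x),g_{\delta,L}(x))\in\mathbb{R}\times\mathbb{R}^n$ such that $$0\le h(y)-h_{\delta,L}(x)-g_{\delta,L}(x)^\top(y-x)\le \frac{L}{2}\|y-x\|^2+\delta\quad\text{for all } y\in\mathbb{R}^n.$$ Here $h$ need not be differentiable. There are $m$ agents. For each time $k\ge1$, $\mathcal{G}_k$ is an undirected graph with node set $\{1,\dots,m\}$ and edge set $\mathcal{E}_k$; $(i,j)\in\mathcal{E}_k$ means agents $i$ and $j$ can communicate at time $k$. The weights $w_{ij}(k)$ are nonnegative, with $w_{ij}(k)>0$ if and only if agent $i$ receives information from agent $j$ at time $k$ (i.e. $i=j$ or $(j,i)\in\mathcal{E}_k$). A square matrix is doubly stochastic if its entries are nonnegative and all its rows and columns sum to $1$. $\|\cdot\|$ is the Euclidean norm. *)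

theory Defs
  imports "HOL-Analysis.Analysis" "Graph_Theory.Pair_Digraph" "Graph_Theory.Digraph_Component"
begin

definition first_order_oracle ::
  "real \<Rightarrow> real \<Rightarrow> ('a::real_inner \<Rightarrow> real) \<Rightarrow> ('a \<Rightarrow> real \<times> 'a) \<Rightarrow> bool"
  where "first_order_oracle \<delta> L h orc \<longleftrightarrow>
    (\<forall>x. case orc x of (v, g) \<Rightarrow>
      (\<forall>y. 0 \<le> h y - v - g \<bullet> (y - x) \<and>
           h y - v - g \<bullet> (y - x) \<le> L / 2 * (norm (y - x))\<^sup>2 + \<delta>))"

definition admits_first_order_oracle ::
  "real \<Rightarrow> real \<Rightarrow> ('a::real_inner \<Rightarrow> real) \<Rightarrow> bool"
  where "admits_first_order_oracle \<delta> L h \<longleftrightarrow> (\<exists>orc. first_order_oracle \<delta> L h orc)"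

definition doubly_stochastic :: "real ^ 'm ^ 'm \<Rightarrow> bool"
  where "doubly_stochastic W \<longleftrightarrow>
    (\<forall>i j. 0 \<le> W $ i $ j) \<and>
    (\<forall>i. (\<Sum>j\<in>UNIV. W $ i $ j) = 1) \<and>
    (\<forall>j. (\<Sum>i\<in>UNIV. W $ i $ j) = 1)"

text \<open>
  An undirected graph is a digraph with a symmetric arc set: an edge between \<open>i\<close> and \<open>j\<close> is
  the pair of arcs \<open>(i, j)\<close> and \<open>(j, i)\<close>. Loops are permitted. The qualified name is needed
  since \<open>connected\<close> may also denote topological connectedness.
\<close>

definition undirected_graph_on :: "'m set \<Rightarrow> 'm pair_pre_digraph \<Rightarrow> bool"
  where "undirected_graph_on V G \<longleftrightarrow> pair_pseudo_graph G \<and> pverts G = V"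

definition graph_connected :: "'m pair_pre_digraph \<Rightarrow> bool"
  where "graph_connected G \<longleftrightarrow> Digraph_Component.connected (with_proj G)"

end

theory Submission
  imports Defs
begin

text \<open>
  Let \<open>p\<close> be a minimiser. The averages form an inexact subgradient method for \<open>F\<close>: because the
  columns of the weight matrices sum to one, mixing does not move the average, which therefore
  changes only by \<open>- \<alpha>\<^sub>k g\<close> with \<open>g\<close> the mean of the oracle vectors. Expanding
  \<open>\<parallel>x\<^sub>a\<^sub>v(k+1) - p\<parallel>\<^sup>2\<close> leaves the inner products of the oracle vectors with \<open>x\<^sub>a\<^sub>v(k) - p\<close> to be
  estimated.

  The oracle vectors belong to the points \<open>x\<^sub>i(k)\<close> rather than to \<open>x\<^sub>a\<^sub>v(k)\<close>. The lower oracle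
  inequality at \<open>p\<close> and the upper one at \<open>x\<^sub>a\<^sub>v(k)\<close>, for the same answer, share the unknown
  approximate value, so that it cancels
  (\<open>inexact_oracle_inner_ge\<close>). The accuracy \<open>\<delta>\<close> is thereby paid once per agent, which is where
  \<open>m \<delta>\<close> comes from, and the other loss is \<open>L/2\<close> times the squared distance of the agents from
  their average. With \<open>D\<^sub>k = m/2 \<parallel>x\<^sub>a\<^sub>v(k) - p\<parallel>\<^sup>2\<close> this gives
  \<open>D\<^sub>k\<^sub>+\<^sub>1 \<le> D\<^sub>k - \<alpha>\<^sub>k (F(x\<^sub>a\<^sub>v(k)) - F(p) - m \<delta> - e\<^sub>k)\<close>, where \<open>e\<^sub>k\<close> collects the disagreement
  term and a multiple of \<open>\<alpha>\<^sub>k\<close>. If \<open>e\<^sub>k\<close> tends to zero, then the bracket cannot stay above a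
  positive constant, since \<open>D\<^sub>k \<ge> 0\<close> and the step sizes have infinite sum
  (\<open>liminf_le_of_descent\<close>).

  It remains to see that the agents reach consensus. Each mixing step shrinks their disagreement
  by a factor below one that is the same for all times (\<open>doubly_stochastic_contraction\<close>), and
  the oracle step adds at most a multiple of \<open>\<alpha>\<^sub>k\<close>, which tends to zero.
\<close>

section \<open>Disagreement of a family of points\<close>

definition mean :: "('m::finite \<Rightarrow> 'a::real_vector) \<Rightarrow> 'a"
  where "mean x = (1 / real CARD('m)) *\<^sub>R (\<Sum>i\<in>UNIV. x i)"

text \<open>
  The norm is that of the product space. Its triangle inequality makes the disagreement a seminorm,
  so that mixing and perturbation can be estimated separately.
\<close>

definition disagreement :: "('m::finite \<Rightarrow> 'a::real_inner) \<Rightarrow> real"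
  where "disagreement x = norm (\<chi> i. x i - mean x)"

lemma disagreement_nonneg: "0 \<le> disagreement x"
  by (simp add: disagreement_def)

lemma disagreement_power2: "(disagreement x)\<^sup>2 = (\<Sum>i\<in>UNIV. (norm (x i - mean x))\<^sup>2)"
  by (simp add: disagreement_def norm_vec_def L2_set_def sum_nonneg)

lemma sum_diff_mean: "(\<Sum>i\<in>UNIV. x i - mean x) = 0"
  by (simp add: mean_def sum_subtractf sum_constant_scaleR)

lemma mean_diff_scaleR: "mean (\<lambda>i. y i - a *\<^sub>R g i) = mean y - a *\<^sub>R mean g"
  by (simp add: mean_def sum_subtractf scaleR_sum_right[symmetric] scaleR_diff_right)

lemma norm_mean_le:
  fixes g :: "'m::finite \<Rightarrow> 'a::real_normed_vector"
  assumes "\<And>i. norm (g i) \<le> C"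
  shows "norm (mean g) \<le> C"
proof -
  have "norm (\<Sum>i\<in>UNIV. g i) \<le> real CARD('m) * C"
    using sum_norm_bound[of UNIV g C] assms by simp
  then show ?thesis
    by (simp add: mean_def field_simps)
qed

lemma disagreement_perturb:
  fixes y g :: "'m::finite \<Rightarrow> 'a::real_inner"
  assumes "0 \<le> a" and g: "\<And>i. norm (g i) \<le> C"
  shows "disagreement (\<lambda>i. y i - a *\<^sub>R g i) \<le> disagreement y + a * (2 * C * real CARD('m))"
proof -
  have "(\<chi> i. (y i - a *\<^sub>R g i) - mean (\<lambda>i. y i - a *\<^sub>R g i))
      = (\<chi> i. y i - mean y) - a *\<^sub>R (\<chi> i. g i - mean g)"
    by (simp add: vec_eq_iff mean_diff_scaleR algebra_simps)
  then have "disagreement (\<lambda>i. y i - a *\<^sub>R g i) \<le> disagreement y + a * disagreement g"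
    using norm_triangle_ineq4[of "\<chi> i. y i - mean y" "a *\<^sub>R (\<chi> i. g i - mean g)"] \<open>0 \<le> a\<close>
    by (simp add: disagreement_def)
  moreover have "disagreement g \<le> 2 * C * real CARD('m)"
  proof -
    have "disagreement g \<le> (\<Sum>i\<in>UNIV. norm (g i - mean g))"
      by (simp add: disagreement_def norm_vec_def L2_set_le_sum)
    also have "\<dots> \<le> (\<Sum>i::'m\<in>UNIV. 2 * C)"
    proof (rule sum_mono)
      fix i :: 'm
      show "norm (g i - mean g) \<le> 2 * C"
        using norm_triangle_ineq4[of "g i" "mean g"] g[of i] norm_mean_le[of g, OF g] by simp
    qed
    finally show ?thesis
      by (simp add: mult.commute)
  qed
  ultimately show ?thesis
    using mult_left_mono[OF _ \<open>0 \<le> a\<close>] by fastforce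
qed

section \<open>One mixing step\<close>

text \<open>
  The identity \<open>E \<parallel>Z - E Z\<parallel>\<^sup>2 = E \<parallel>Z\<parallel>\<^sup>2 - \<parallel>E Z\<parallel>\<^sup>2\<close> for the distribution with weights \<open>w\<close>.
\<close>

lemma convex_combination_variance:
  fixes z :: "'m::finite \<Rightarrow> 'a::real_inner"
  assumes "(\<Sum>j\<in>UNIV. w j) = 1"
  defines "y \<equiv> \<Sum>j\<in>UNIV. w j *\<^sub>R z j"
  shows "(\<Sum>j\<in>UNIV. w j * (norm (z j - y))\<^sup>2) = (\<Sum>j\<in>UNIV. w j * (norm (z j))\<^sup>2) - (norm y)\<^sup>2"
proof -
  have "w j * (norm (z j - y))\<^sup>2
      = w j * (norm (z j))\<^sup>2 - 2 * ((w j *\<^sub>R z j) \<bullet> y) + w j * (norm y)\<^sup>2" for j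
    by (simp add: power2_norm_eq_inner inner_diff_left inner_diff_right inner_commute algebra_simps)
  then have "(\<Sum>j\<in>UNIV. w j * (norm (z j - y))\<^sup>2)
      = (\<Sum>j\<in>UNIV. w j * (norm (z j))\<^sup>2) - 2 * (y \<bullet> y) + (\<Sum>j\<in>UNIV. w j) * (norm y)\<^sup>2"
    by (simp add: sum.distrib sum_subtractf sum_distrib_left sum_distrib_right y_def inner_sum_left)
  then show ?thesis
    using assms(1) by (simp add: power2_norm_eq_inner)
qed

lemma power2_norm_diff_le:
  fixes a b :: "'a::real_inner"
  shows "(norm (a - b))\<^sup>2 \<le> 2 * (norm a)\<^sup>2 + 2 * (norm b)\<^sup>2"
proof -
  have "0 \<le> (norm (a + b))\<^sup>2"
    by simp
  then show ?thesis
    by (simp add: power2_norm_eq_inner inner_diff_left inner_diff_right inner_add_left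
        inner_add_right inner_commute)
qed

text \<open>
  Summing the variance identity over the rows shows that mixing lowers the sum of squares by
  exactly the total of the row variances, as the columns sum to one. If node \<open>i\<close> gives weight at
  least \<open>\<eta>\<close> to itself and to \<open>j\<close>, then the variance of row \<open>i\<close> alone is at least \<open>\<eta>\<close> times the sum of the
  squared distances of \<open>z i\<close> and \<open>z j\<close> to a common point.
\<close>

lemma doubly_stochastic_edge_drop:
  fixes z :: "'m::finite \<Rightarrow> 'a::real_inner" and W :: "real ^ 'm ^ 'm"
  assumes ds: "doubly_stochastic W" and "0 \<le> \<eta>"
    and diag: "\<eta> \<le> W $ i $ i" and edge: "\<eta> \<le> W $ i $ j"
  shows "(\<Sum>i\<in>UNIV. (norm (\<Sum>j\<in>UNIV. W $ i $ j *\<^sub>R z j))\<^sup>2) + \<eta> / 2 * (norm (z j - z i))\<^sup>2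
      \<le> (\<Sum>i\<in>UNIV. (norm (z i))\<^sup>2)"
proof -
  define y where "y = (\<lambda>i. \<Sum>j\<in>UNIV. W $ i $ j *\<^sub>R z j)"
  define v where "v = (\<lambda>i. \<Sum>j\<in>UNIV. W $ i $ j * (norm (z j - y i))\<^sup>2)"
  have nonneg: "0 \<le> W $ i $ j" and row: "(\<Sum>j\<in>UNIV. W $ i $ j) = 1"
    and col: "(\<Sum>i\<in>UNIV. W $ i $ j) = 1" for i j
    using ds by (auto simp: doubly_stochastic_def)
  have "(\<Sum>i\<in>UNIV. \<Sum>j\<in>UNIV. W $ i $ j * (norm (z j))\<^sup>2) = (\<Sum>j\<in>UNIV. (norm (z j))\<^sup>2)"
    by (subst sum.swap) (simp add: sum_distrib_right[symmetric] col)
  moreover have "v i = (\<Sum>j\<in>UNIV. W $ i $ j * (norm (z j))\<^sup>2) - (norm (y i))\<^sup>2" for i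
    unfolding v_def y_def by (rule convex_combination_variance[OF row])
  ultimately have total: "(\<Sum>i\<in>UNIV. v i) = (\<Sum>j\<in>UNIV. (norm (z j))\<^sup>2) - (\<Sum>i\<in>UNIV. (norm (y i))\<^sup>2)"
    by (simp add: sum_subtractf)
  have "v i \<le> (\<Sum>i\<in>UNIV. v i)"
    by (rule member_le_sum) (auto simp: v_def intro!: sum_nonneg mult_nonneg_nonneg nonneg)
  moreover have "\<eta> / 2 * (norm (z j - z i))\<^sup>2 \<le> v i"
  proof (cases "i = j")
    case True
    then show ?thesis
      by (auto simp: v_def intro!: sum_nonneg mult_nonneg_nonneg nonneg)
  next
    case False
    have "(norm (z j - z i))\<^sup>2 \<le> 2 * (norm (z j - y i))\<^sup>2 + 2 * (norm (z i - y i))\<^sup>2"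
      using power2_norm_diff_le[of "z j - y i" "z i - y i"] by simp
    from mult_left_mono[OF this \<open>0 \<le> \<eta>\<close>]
    have "\<eta> / 2 * (norm (z j - z i))\<^sup>2 \<le> \<eta> * (norm (z j - y i))\<^sup>2 + \<eta> * (norm (z i - y i))\<^sup>2"
      by (simp add: algebra_simps)
    also have "\<dots> \<le> W $ i $ j * (norm (z j - y i))\<^sup>2 + W $ i $ i * (norm (z i - y i))\<^sup>2"
      by (intro add_mono mult_right_mono diag edge) auto
    also have "\<dots> = (\<Sum>l\<in>{i, j}. W $ i $ l * (norm (z l - y i))\<^sup>2)"
      using False by simp
    also have "\<dots> \<le> v i"
      unfolding v_def by (rule sum_mono2) (auto intro!: mult_nonneg_nonneg nonneg)
    finally show ?thesis .
  qed
  ultimately show ?thesis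
    using total by (simp add: y_def)
qed

lemma norm_diff_relpow_le:
  fixes z :: "'m \<Rightarrow> 'a::real_normed_vector"
  assumes "\<And>i j. (i, j) \<in> R \<Longrightarrow> norm (z i - z j) \<le> s" and "(a, b) \<in> R ^^ n"
  shows "norm (z a - z b) \<le> real n * s"
  using assms(2)
proof (induction n arbitrary: b)
  case 0
  then show ?case by simp
next
  case (Suc n)
  then obtain c where "(a, c) \<in> R ^^ n" "(c, b) \<in> R"
    by auto
  then have "norm (z a - z c) + norm (z c - z b) \<le> real n * s + s"
    using Suc.IH assms(1) by (meson add_mono)
  then show ?case
    using norm_triangle_ineq[of "z a - z c" "z c - z b"] by (simp add: algebra_simps)
qed

text \<open>
  The crude bound on the length of a path by the number of ordered pairs of nodes suffices: any
  bound that depends on the number of nodes only makes the contraction factor independent of the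
  graph.
\<close>

lemma norm_diff_connected_le:
  fixes z :: "'m::finite \<Rightarrow> 'a::real_normed_vector"
  assumes "\<And>i j. (i, j) \<in> R \<Longrightarrow> norm (z i - z j) \<le> s" and "0 \<le> s" and "(a, b) \<in> R\<^sup>*"
  shows "norm (z a - z b) \<le> (real CARD('m))\<^sup>2 * s"
proof -
  obtain n where n: "n \<le> card R" "(a, b) \<in> R ^^ n"
    using assms(3) by (auto simp: rtrancl_finite_eq_relpow)
  have "card R \<le> CARD('m \<times> 'm)"
    by (rule card_mono) auto
  then have "real n \<le> (real CARD('m))\<^sup>2"
    using n(1) by (simp add: power2_eq_square flip: of_nat_mult)
  then show ?thesis
    using norm_diff_relpow_le[of R z s a b n, OF assms(1) n(2)] mult_right_mono[OF _ \<open>0 \<le> s\<close>]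
    by (meson order_trans)
qed

lemma sum_power2_norm_centered_le:
  fixes z :: "'m::finite \<Rightarrow> 'a::real_inner"
  assumes centered: "(\<Sum>i\<in>UNIV. z i) = 0" and d: "\<And>a b. norm (z a - z b) \<le> d"
  shows "(\<Sum>i\<in>UNIV. (norm (z i))\<^sup>2) \<le> real CARD('m) * d\<^sup>2"
proof -
  have "norm (z a) \<le> d" for a
  proof -
    have "mean (\<lambda>b. z a - z b) = z a"
      using centered by (simp add: mean_def sum_subtractf sum_constant_scaleR)
    then show ?thesis
      using norm_mean_le[of "\<lambda>b. z a - z b" d] d by simp
  qed
  then have "(\<Sum>i\<in>UNIV. (norm (z i))\<^sup>2) \<le> (\<Sum>i::'m\<in>UNIV. d\<^sup>2)"
    by (intro sum_mono power_mono) auto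
  then show ?thesis by simp
qed

text \<open>
  If mixing barely lowers the sum of squares, then by \<open>doubly_stochastic_edge_drop\<close> neighbours are
  close, hence along paths all nodes are close, hence the centred sum of squares is small. So the
  drop is at least a fixed fraction of that sum. The factor \<open>m\<^sup>5\<close> is \<open>m\<close> summands times the square
  of the path bound \<open>m\<^sup>2\<close>.
\<close>

lemma doubly_stochastic_contraction:
  fixes x :: "'m::finite \<Rightarrow> 'a::real_inner" and W :: "real ^ 'm ^ 'm"
  assumes ds: "doubly_stochastic W" and "0 < \<eta>"
    and diag: "\<And>i. \<eta> \<le> W $ i $ i" and edge: "\<And>i j. (j, i) \<in> R \<Longrightarrow> \<eta> \<le> W $ i $ j"
    and conn: "\<And>a b. (a, b) \<in> R\<^sup>*"
  shows "disagreement (\<lambda>i. \<Sum>j\<in>UNIV. W $ i $ j *\<^sub>R x j)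
      \<le> sqrt (1 - \<eta> / (2 * real CARD('m) ^ 5)) * disagreement x"
    and "mean (\<lambda>i. \<Sum>j\<in>UNIV. W $ i $ j *\<^sub>R x j) = mean x"
proof -
  let ?m = "real CARD('m)" and ?y = "\<lambda>i. \<Sum>j\<in>UNIV. W $ i $ j *\<^sub>R x j"
  define z where "z = (\<lambda>i. x i - mean x)"
  define U where "U = (\<Sum>i\<in>UNIV. (norm (z i))\<^sup>2)"
  define V where "V = (\<Sum>i\<in>UNIV. (norm (\<Sum>j\<in>UNIV. W $ i $ j *\<^sub>R z j))\<^sup>2)"
  have row: "(\<Sum>j\<in>UNIV. W $ i $ j) = 1" and col: "(\<Sum>i\<in>UNIV. W $ i $ j) = 1" for i j
    using ds by (auto simp: doubly_stochastic_def)
  have "(\<Sum>i\<in>UNIV. ?y i) = (\<Sum>j\<in>UNIV. x j)"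
    by (subst sum.swap) (simp add: scaleR_sum_left[symmetric] col)
  then show mean_y: "mean ?y = mean x"
    by (simp add: mean_def)
  have drop: "V + \<eta> / 2 * (norm (z j - z i))\<^sup>2 \<le> U" if "\<eta> \<le> W $ i $ j" for i j
    unfolding U_def V_def
    using doubly_stochastic_edge_drop[OF ds less_imp_le[OF \<open>0 < \<eta>\<close>] diag[of i] that] .
  \<comment> \<open>The largest distance that the drop \<open>U - V\<close> allows between neighbours.\<close>
  define s where "s = sqrt (2 / \<eta> * (U - V))"
  have "V \<le> U"
    using drop[OF diag] by simp
  then have s: "0 \<le> s" "s\<^sup>2 = 2 / \<eta> * (U - V)"
    using \<open>0 < \<eta>\<close> by (auto simp: s_def)
  have "norm (z a - z b) \<le> ?m\<^sup>2 * s" for a b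
  proof (rule norm_diff_connected_le[OF _ s(1) conn])
    fix i j assume "(i, j) \<in> R"
    then have "(norm (z i - z j))\<^sup>2 \<le> 2 / \<eta> * (U - V)"
      using drop[OF edge] \<open>0 < \<eta>\<close> by (simp add: field_simps)
    then show "norm (z i - z j) \<le> s"
      unfolding s_def by (rule real_le_rsqrt)
  qed
  then have "U \<le> ?m * (?m\<^sup>2 * s)\<^sup>2"
    unfolding U_def using sum_diff_mean[of x] by (intro sum_power2_norm_centered_le) (simp_all add: z_def)
  also have "\<dots> = ?m ^ 5 * s\<^sup>2"
    by (simp add: power2_eq_square eval_nat_numeral)
  also have "\<dots> = ?m ^ 5 * (2 / \<eta> * (U - V))"
    by (simp only: s(2))
  finally have "V \<le> (1 - \<eta> / (2 * ?m ^ 5)) * U"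
    using \<open>0 < \<eta>\<close> by (simp add: field_simps)
  moreover have "?y i - mean ?y = (\<Sum>j\<in>UNIV. W $ i $ j *\<^sub>R z j)" for i
    unfolding mean_y z_def
    by (simp add: scaleR_diff_right sum_subtractf scaleR_sum_left[symmetric] row)
  ultimately have "(disagreement ?y)\<^sup>2 \<le> (1 - \<eta> / (2 * ?m ^ 5)) * (disagreement x)\<^sup>2"
    unfolding disagreement_power2 U_def V_def z_def by simp
  then have "sqrt ((disagreement ?y)\<^sup>2) \<le> sqrt ((1 - \<eta> / (2 * ?m ^ 5)) * (disagreement x)\<^sup>2)"
    by (rule real_sqrt_le_mono)
  then show "disagreement ?y \<le> sqrt (1 - \<eta> / (2 * ?m ^ 5)) * disagreement x"
    by (simp add: real_sqrt_mult disagreement_nonneg)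
qed

section \<open>Two recursive inequalities for real sequences\<close>

text \<open>
  Once \<open>e k < (1 - q) * \<rho>\<close>, the excess \<open>r k - \<rho>\<close> over the fixed point \<open>\<rho>\<close> of the recursion
  with constant error \<open>(1 - q) * \<rho>\<close> is multiplied by at most \<open>q\<close> in each step.
\<close>

lemma contraction_with_vanishing_error:
  fixes r e :: "nat \<Rightarrow> real"
  assumes nonneg: "\<And>k. 0 \<le> r k" and q: "0 \<le> q" "q < 1" and e: "e \<longlonglongrightarrow> 0"
    and step: "\<And>k. k \<ge> N \<Longrightarrow> r (Suc k) \<le> q * r k + e k"
  shows "r \<longlonglongrightarrow> 0"
proof (rule LIMSEQ_I)
  fix \<epsilon> :: real assume "0 < \<epsilon>"
  define \<rho> where "\<rho> = \<epsilon> / 2"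
  have "0 < (1 - q) * \<rho>"
    using q \<open>0 < \<epsilon>\<close> by (simp add: \<rho>_def)
  then have "\<forall>\<^sub>F k in sequentially. e k < (1 - q) * \<rho>"
    using e by (rule order_tendstoD(2)[rotated])
  then obtain M where M: "M \<ge> N" "\<And>k. k \<ge> M \<Longrightarrow> e k < (1 - q) * \<rho>"
    unfolding eventually_sequentially by (meson le_trans nat_le_linear)
  have bound: "r (M + n) - \<rho> \<le> q ^ n * r M" for n
  proof (induction n)
    case 0
    then show ?case using \<open>0 < \<epsilon>\<close> by (simp add: \<rho>_def)
  next
    case (Suc n)
    have "r (M + Suc n) - \<rho> \<le> q * (r (M + n) - \<rho>)"
      using step[of "M + n"] M(2)[of "M + n"] M(1) by (simp add: algebra_simps)
    also have "\<dots> \<le> q * (q ^ n * r M)"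
      by (rule mult_left_mono[OF Suc q(1)])
    finally show ?case by (simp add: mult.assoc)
  qed
  have "(\<lambda>n. q ^ n * r M) \<longlonglongrightarrow> 0 * r M"
    by (intro tendsto_intros LIMSEQ_realpow_zero q)
  then have "\<forall>\<^sub>F n in sequentially. q ^ n * r M < \<rho>"
    using \<open>0 < \<epsilon>\<close> by (intro order_tendstoD(2)) (auto simp: \<rho>_def)
  then obtain n0 where n0: "\<And>n. n \<ge> n0 \<Longrightarrow> q ^ n * r M < \<rho>"
    by (auto simp: eventually_sequentially)
  have "norm (r k - 0) < \<epsilon>" if "k \<ge> M + n0" for k
  proof -
    have "k = M + (k - M)" "n0 \<le> k - M"
      using that by auto
    then show ?thesis
      using bound[of "k - M"] n0[of "k - M"] nonneg[of k] by (simp add: \<rho>_def)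
  qed
  then show "\<exists>k0. \<forall>k\<ge>k0. norm (r k - 0) < \<epsilon>"
    by blast
qed

text \<open>
  If \<open>\<phi>\<close> eventually exceeded some \<open>b > c\<close>, then \<open>D\<close> would eventually fall by at least a fixed multiple of
  \<open>\<alpha> k\<close> in each step. These decrements have infinite sum, but \<open>D\<close> is bounded below.
\<close>

lemma liminf_le_of_descent:
  fixes D \<phi> e \<alpha> :: "nat \<Rightarrow> real"
  assumes D_nonneg: "\<And>k. 0 \<le> D k" and \<alpha>_nonneg: "\<And>k. 1 \<le> k \<Longrightarrow> 0 \<le> \<alpha> k"
    and diverges: "filterlim (\<lambda>K. \<Sum>k=1..K. \<alpha> k) at_top sequentially"
    and e: "e \<longlonglongrightarrow> 0"
    and descent: "\<And>k. 1 \<le> k \<Longrightarrow> D (Suc k) \<le> D k - \<alpha> k * (\<phi> k - c - e k)"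
  shows "liminf (\<lambda>k. ereal (\<phi> k)) \<le> ereal c"
proof (rule ccontr)
  assume "\<not> liminf (\<lambda>k. ereal (\<phi> k)) \<le> ereal c"
  then obtain b where b: "ereal c < ereal b" "ereal b < liminf (\<lambda>k. ereal (\<phi> k))"
    using ereal_dense2[of "ereal c"] by (auto simp: not_le)
  define \<epsilon> where "\<epsilon> = (b - c) / 2"
  have "0 < \<epsilon>"
    using b(1) by (simp add: \<epsilon>_def)
  have "\<forall>\<^sub>F k in sequentially. b < \<phi> k"
    using less_LiminfD[OF b(2)] by simp
  moreover have "\<forall>\<^sub>F k in sequentially. e k < \<epsilon>"
    using order_tendstoD(2)[OF e \<open>0 < \<epsilon>\<close>] .
  ultimately have "\<forall>\<^sub>F k in sequentially. \<epsilon> \<le> \<phi> k - c - e k"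
    by eventually_elim (simp add: \<epsilon>_def field_simps)
  then obtain M where M: "1 \<le> M" "\<And>k. k \<ge> M \<Longrightarrow> \<epsilon> \<le> \<phi> k - c - e k"
    unfolding eventually_sequentially by (meson le_trans nat_le_linear)
  have drop: "D (Suc k) \<le> D k - \<epsilon> * \<alpha> k" if "k \<ge> M" for k
    using descent[of k] mult_left_mono[OF M(2)[OF that] \<alpha>_nonneg[of k]] M(1) that
    by (simp add: mult.commute)
  define S where "S = (\<lambda>K. \<Sum>k=1..K. \<alpha> k)"
  have "D (Suc K) + \<epsilon> * S K \<le> D (Suc M) + \<epsilon> * S M" if "K \<ge> M" for K
    using that
  proof (induction K rule: dec_induct)
    case base
    then show ?case by simp
  next
    case (step K)
    then show ?case
      using drop[of "Suc K"] by (simp add: S_def algebra_simps)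
  qed
  then have "S K \<le> (D (Suc M) + \<epsilon> * S M) / \<epsilon>" if "K \<ge> M" for K
    using that D_nonneg[of "Suc K"] \<open>0 < \<epsilon>\<close> by (fastforce simp: field_simps)
  moreover have "\<forall>\<^sub>F K in sequentially. (D (Suc M) + \<epsilon> * S M) / \<epsilon> < S K"
    using diverges unfolding S_def filterlim_at_top_dense by blast
  then obtain K where "K \<ge> M" "(D (Suc M) + \<epsilon> * S M) / \<epsilon> < S K"
    unfolding eventually_sequentially by (meson nat_le_linear)
  ultimately show False
    by (meson leD)
qed

section \<open>The oracle and the communication graph\<close>

text \<open>
  Splitting \<open>g \<bullet> (z - y) = g \<bullet> (x - y) + g \<bullet> (z - x)\<close>, the first summand is at least \<open>v - h y\<close> by
  the lower oracle inequality at \<open>y\<close>, and the second at least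
  \<open>h z - v - L/2 \<parallel>z - x\<parallel>\<^sup>2 - \<delta>\<close> by the upper one at \<open>z\<close>. In the sum the approximate value \<open>v\<close> cancels;
  replacing it by \<open>h x\<close> in both inequalities would cost a second \<open>\<delta>\<close>.
\<close>

lemma inexact_oracle_inner_ge:
  fixes h :: "'a::real_inner \<Rightarrow> real"
  assumes orc: "first_order_oracle \<delta> L h orc" and answer: "(v, g) = orc x"
  shows "h z - h y - \<delta> - L / 2 * (norm (x - z))\<^sup>2 \<le> g \<bullet> (z - y)"
proof -
  have "case orc x of (v, g) \<Rightarrow> (\<forall>y. 0 \<le> h y - v - g \<bullet> (y - x) \<and>
      h y - v - g \<bullet> (y - x) \<le> L / 2 * (norm (y - x))\<^sup>2 + \<delta>)"
    using orc by (auto simp: first_order_oracle_def)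
  then have "0 \<le> h y - v - g \<bullet> (y - x)"
    and "h z - v - g \<bullet> (z - x) \<le> L / 2 * (norm (z - x))\<^sup>2 + \<delta>"
    by (auto simp: answer[symmetric])
  then show ?thesis
    by (simp add: inner_diff_right norm_minus_commute)
qed

lemma graph_connected_rtrancl:
  assumes "undirected_graph_on UNIV G" and "graph_connected G"
  shows "(a, b) \<in> (parcs G)\<^sup>*"
proof -
  interpret pair_pseudo_graph G
    using assms(1) by (simp add: undirected_graph_on_def)
  have "strongly_connected (with_proj G)"
    using assms(2) symmetric_connected_imp_strongly_connected[OF pair_sym_arcs]
    by (simp add: graph_connected_def)
  then have "a \<rightarrow>\<^sup>*\<^bsub>with_proj G\<^esub> b"
    using assms(1) by (auto simp: strongly_connected_def undirected_graph_on_def)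
  then show ?thesis
    using reachable_rtranclI by fastforce
qed

section \<open>Convergence of the distributed subgradient method\<close>

theorem theorem2:
  fixes f :: "'m::finite \<Rightarrow> real ^ 'n::finite \<Rightarrow> real"
    and F :: "real ^ 'n \<Rightarrow> real"
    and fstar \<delta> L C \<eta> :: real
    and G :: "nat \<Rightarrow> 'm pair_pre_digraph"
    and W :: "nat \<Rightarrow> real ^ 'm ^ 'm"
    and \<alpha> :: "nat \<Rightarrow> real"
    and x :: "'m \<Rightarrow> nat \<Rightarrow> real ^ 'n"
    and xav :: "nat \<Rightarrow> real ^ 'n"
    and fd :: "'m \<Rightarrow> nat \<Rightarrow> real"
    and gd :: "'m \<Rightarrow> nat \<Rightarrow> real ^ 'n"
  assumes F_def: "\<And>z. F z = (\<Sum>i\<in>UNIV. f i z)"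
    and fstar_le: "\<And>z. fstar \<le> F z"
    and argmin_nonempty: "{z. F z = fstar} \<noteq> {}"
    and delta_nonneg: "0 \<le> \<delta>"
    and graph: "\<And>k. 1 \<le> k \<Longrightarrow> undirected_graph_on UNIV (G k)"
    and weights_pos_iff:
      "\<And>k i j. 1 \<le> k \<Longrightarrow> 0 < W k $ i $ j \<longleftrightarrow> i = j \<or> (j, i) \<in> parcs (G k)"
    and iteration: "\<And>k i. 1 \<le> k \<Longrightarrow>
      x i (k + 1) = (\<Sum>j\<in>UNIV. W k $ i $ j *\<^sub>R x j k) - \<alpha> k *\<^sub>R gd i k"
    and oracle_answer: "\<And>k i. 1 \<le> k \<Longrightarrow>
      \<exists>orc. first_order_oracle \<delta> L (f i) orc \<and> (fd i k, gd i k) = orc (x i k)"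
    and xav_def: "\<And>k. 1 \<le> k \<Longrightarrow> xav k = (1 / real CARD('m)) *\<^sub>R (\<Sum>i\<in>UNIV. x i k)"
    and convex: "\<And>i. convex_on UNIV (f i)"
    and admits_oracle: "\<And>i. admits_first_order_oracle \<delta> L (f i)"
    and C_pos: "0 < C"
    and gd_bounded: "\<And>k i. 1 \<le> k \<Longrightarrow> norm (gd i k) \<le> C"
    and connected: "\<And>k. 1 \<le> k \<Longrightarrow> graph_connected (G k)"
    and doubly_stoch: "\<And>k. 1 \<le> k \<Longrightarrow> doubly_stochastic (W k)"
    and eta_pos: "0 < \<eta>"
    and eta_diag: "\<And>k i. 1 \<le> k \<Longrightarrow> \<eta> \<le> W k $ i $ i"
    and eta_edge: "\<And>k i j. 1 \<le> k \<Longrightarrow> (j, i) \<in> parcs (G k) \<Longrightarrow> \<eta> \<le> W k $ i $ j"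
    and step_pos: "\<And>k. 1 \<le> k \<Longrightarrow> 0 < \<alpha> k"
    and step_diverges: "filterlim (\<lambda>K. \<Sum>k=1..K. \<alpha> k) at_top sequentially"
    and step_square_summable: "summable (\<lambda>k. (\<alpha> (k + 1))\<^sup>2)"
  shows "liminf (\<lambda>k. ereal (F (xav k))) \<le> ereal (fstar + real CARD('m) * \<delta>)"
proof -
  let ?m = "real CARD('m)"
  define y where "y = (\<lambda>k i. \<Sum>j\<in>UNIV. W k $ i $ j *\<^sub>R x j k)"
  have mean_x: "mean (\<lambda>i. x i k) = xav k" if "1 \<le> k" for k
    using xav_def[OF that] by (simp add: mean_def)
  have x_Suc: "(\<lambda>i. x i (Suc k)) = (\<lambda>i. y k i - \<alpha> k *\<^sub>R gd i k)" if "1 \<le> k" for k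
    using iteration[OF that] by (simp add: y_def)
  have alpha0: "\<alpha> \<longlonglongrightarrow> 0"
  proof -
    have "(\<lambda>k. sqrt ((\<alpha> (k + 1))\<^sup>2)) \<longlonglongrightarrow> sqrt 0"
      using summable_LIMSEQ_zero[OF step_square_summable] by (rule tendsto_real_sqrt)
    then have "(\<lambda>k. \<alpha> (k + 1)) \<longlonglongrightarrow> 0"
      by (simp add: tendsto_rabs_zero_iff)
    then show ?thesis
      by (rule LIMSEQ_offset)
  qed
  define r where "r = (\<lambda>k. disagreement (\<lambda>i. x i k))"
  define q where "q = sqrt (1 - \<eta> / (2 * ?m ^ 5))"
  have mix: "disagreement (y k) \<le> q * r k" "mean (y k) = xav k" if "1 \<le> k" for k
    using doubly_stochastic_contraction[OF doubly_stoch[OF that] eta_pos eta_diag[OF that]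
        eta_edge[OF that] graph_connected_rtrancl[OF graph[OF that] connected[OF that]],
        of "\<lambda>j. x j k"] mean_x[OF that]
    by (simp_all add: y_def q_def r_def)
  have r0: "r \<longlonglongrightarrow> 0"
  proof (rule contraction_with_vanishing_error)
    show "0 \<le> r k" for k
      by (simp add: r_def disagreement_nonneg)
    have "W 1 $ i $ i \<le> (\<Sum>j\<in>UNIV. W 1 $ i $ j)" for i
      using doubly_stoch[of 1] by (intro member_le_sum) (auto simp: doubly_stochastic_def)
    then have "\<eta> \<le> 1"
      using eta_diag[of 1] doubly_stoch[of 1]
      by (metis doubly_stochastic_def order_refl order_trans)
    moreover have "1 \<le> ?m ^ 5"
      by (simp add: Suc_leI)
    ultimately have "\<eta> \<le> 2 * ?m ^ 5"
      by linarith
    then show "0 \<le> q" "q < 1"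
      using eta_pos by (auto simp: q_def field_simps)
    have "(\<lambda>k. \<alpha> k * (2 * C * ?m)) \<longlonglongrightarrow> 0 * (2 * C * ?m)"
      by (intro tendsto_intros alpha0)
    then show "(\<lambda>k. \<alpha> k * (2 * C * ?m)) \<longlonglongrightarrow> 0"
      by simp
    show "r (Suc k) \<le> q * r k + \<alpha> k * (2 * C * ?m)" if "1 \<le> k" for k
      using disagreement_perturb[of "\<alpha> k" "\<lambda>i. gd i k" C "y k"] mix(1)[OF that] x_Suc[OF that]
        step_pos[OF that] gd_bounded[OF that] by (simp add: r_def)
  qed
  obtain p where p: "F p = fstar"
    using argmin_nonempty by auto
  \<comment> \<open>The factor \<open>m / 2\<close> turns the mean of the oracle vectors into their sum, so that \<open>F\<close> itself,
    and not \<open>F / m\<close>, appears in the descent inequality.\<close>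
  define D where "D = (\<lambda>k. ?m / 2 * (norm (xav k - p))\<^sup>2)"
  define e where "e = (\<lambda>k. L / 2 * (r k)\<^sup>2 + ?m * C\<^sup>2 / 2 * \<alpha> k)"
  show ?thesis
  proof (rule liminf_le_of_descent[OF _ _ step_diverges])
    show "0 \<le> D k" for k
      by (simp add: D_def)
    show "0 \<le> \<alpha> k" if "1 \<le> k" for k
      using step_pos[OF that] by simp
    have "e \<longlonglongrightarrow> L / 2 * 0\<^sup>2 + ?m * C\<^sup>2 / 2 * 0"
      unfolding e_def by (intro tendsto_intros r0 alpha0)
    then show "e \<longlonglongrightarrow> 0"
      by simp
    show "D (Suc k) \<le> D k - \<alpha> k * (F (xav k) - (fstar + ?m * \<delta>) - e k)" if k: "1 \<le> k" for k
    proof -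
      define g where "g = mean (\<lambda>i. gd i k)"
      define a where "a = xav k - p"
      have "f i (xav k) - f i p - \<delta> - L / 2 * (norm (x i k - xav k))\<^sup>2 \<le> gd i k \<bullet> a" for i
        using oracle_answer[OF k, of i] inexact_oracle_inner_ge unfolding a_def by metis
      then have "(\<Sum>i\<in>UNIV. f i (xav k) - f i p - \<delta> - L / 2 * (norm (x i k - xav k))\<^sup>2)
          \<le> (\<Sum>i\<in>UNIV. gd i k \<bullet> a)"
        by (rule sum_mono)
      moreover have "(\<Sum>i\<in>UNIV. gd i k \<bullet> a) = ?m * (g \<bullet> a)"
        by (simp add: g_def mean_def inner_sum_left)
      ultimately have inner: "F (xav k) - (fstar + ?m * \<delta>) - L / 2 * (r k)\<^sup>2 \<le> ?m * (g \<bullet> a)"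
        unfolding r_def disagreement_power2 mean_x[OF k]
        by (simp add: F_def p[symmetric] sum_subtractf sum_distrib_left)
      have "norm g \<le> C"
        unfolding g_def by (rule norm_mean_le[OF gd_bounded[OF k]])
      then have "(norm g)\<^sup>2 \<le> C\<^sup>2"
        by (rule power_mono) simp
      then have g: "?m / 2 * (\<alpha> k)\<^sup>2 * (norm g)\<^sup>2 \<le> ?m / 2 * (\<alpha> k)\<^sup>2 * C\<^sup>2"
        by (intro mult_left_mono) auto
      have xav_Suc: "xav (Suc k) - p = a - \<alpha> k *\<^sub>R g"
        using mean_x[of "Suc k"] k mix(2)[OF k] by (simp add: x_Suc mean_diff_scaleR g_def a_def)
      have sq: "(norm (a - \<alpha> k *\<^sub>R g))\<^sup>2
          = (norm a)\<^sup>2 - 2 * \<alpha> k * (g \<bullet> a) + (\<alpha> k)\<^sup>2 * (norm g)\<^sup>2"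
        unfolding power2_norm_eq_inner
        by (simp add: inner_diff_left inner_diff_right inner_commute algebra_simps power2_eq_square)
      have "D (Suc k)
          = D k - \<alpha> k * (?m * (g \<bullet> a)) + ?m / 2 * (\<alpha> k)\<^sup>2 * (norm g)\<^sup>2"
        unfolding D_def xav_Suc sq a_def[symmetric] by (simp add: field_simps)
      also have "\<dots> \<le> D k
          - \<alpha> k * (F (xav k) - (fstar + ?m * \<delta>) - L / 2 * (r k)\<^sup>2) + ?m / 2 * (\<alpha> k)\<^sup>2 * C\<^sup>2"
        using mult_left_mono[OF inner less_imp_le[OF step_pos[OF k]]] g by linarith
      also have "\<dots> = D k - \<alpha> k * (F (xav k) - (fstar + ?m * \<delta>) - e k)"
        by (simp add: e_def algebra_simps power2_eq_square)
      finally show ?thesis .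
    qed
  qed
qed

end
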